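(* Let $k=3$ and $r_1\ge r_2\ge r_3\ge 1$. If $(r_1-1)< (r_2-1)+(r_3-1)$, then the arithmetic mean component competitive ratio for the 3-objective time series search problem is $$z_f^3=\frac16\left\{\sqrt{4r_3+(r_1-r_2)^2}+(r_1+1)+(r_2+1)\right\}.$$
   Context: For an integer $k\ge 2$ and reals $0<m_i\le M_i$ ($1\le i\le k$), let $r_i=M_i/m_i$ be the fluctuation ratio of the price interval $[m_i,M_i]$ of the $i$th objective. It is assumed throughout that $r_1\ge\cdots\ge r_k\ge 1$. The arithmetic mean component competitive ratio of the $k$-objective time series search problem is the quantity $$z_f^k=\sup_{(x_1,\ldots,x_k)\in\mathcal{S}_f^k}\frac1k\left(\frac{M_1}{x_1}+\cdots+\frac{M_k}{x_k}\right),$$ where $$\mathcal{S}_f^k=\left\{(x_1,\ldots,x_k)\in[m_1,M_1]\times\cdots\times[m_k,M_k] : \frac1k\sum_{i=1}^k\frac{x_i}{m_i}=\frac1k\sum_{i=1}^k\frac{M_i}{x_i}\right\}.$$ *)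

theory Defs
  imports "HOL-Analysis.Analysis"
begin

text \<open>
  The price interval of the \<open>i\<close>th objective (\<open>1 \<le> i \<le> k\<close>) is \<open>[m i, M i]\<close>.  Since the number \<open>k\<close> of
  objectives is a parameter, \<open>k\<close>-tuples are functions on \<open>{1..k}\<close> that are \<open>undefined\<close> elsewhere.
\<close>

definition price_intervals :: "nat \<Rightarrow> (nat \<Rightarrow> real) \<Rightarrow> (nat \<Rightarrow> real) \<Rightarrow> bool" where
  "price_intervals k m M \<longleftrightarrow> k \<ge> 2 \<and> (\<forall>i\<in>{1..k}. 0 < m i \<and> m i \<le> M i)"

definition fluctuation_ratio :: "(nat \<Rightarrow> real) \<Rightarrow> (nat \<Rightarrow> real) \<Rightarrow> nat \<Rightarrow> real" where
  "fluctuation_ratio m M i = M i / m i"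

definition S_f :: "nat \<Rightarrow> (nat \<Rightarrow> real) \<Rightarrow> (nat \<Rightarrow> real) \<Rightarrow> (nat \<Rightarrow> real) set" where
  "S_f k m M = {x \<in> (\<Pi>\<^sub>E i\<in>{1..k}. {m i..M i}).
     (1 / real k) * (\<Sum>i=1..k. x i / m i) = (1 / real k) * (\<Sum>i=1..k. M i / x i)}"

text \<open>
  The supremum below is one of real numbers.  If \<open>price_intervals k m M\<close> holds, the set is nonempty
  (take \<open>x i = sqrt (m i * M i)\<close>) and bounded above, so that \<open>Sup\<close> is the true supremum.
\<close>

definition z_f :: "nat \<Rightarrow> (nat \<Rightarrow> real) \<Rightarrow> (nat \<Rightarrow> real) \<Rightarrow> real" where
  "z_f k m M = (SUP x\<in>S_f k m M. (1 / real k) * (\<Sum>i=1..k. M i / x i))"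

end

theory Submission
  imports Defs
begin

text \<open>
  Put \<open>u\<^sub>i = x\<^sub>i / m\<^sub>i\<close>, \<open>v\<^sub>i = M\<^sub>i / x\<^sub>i\<close> and \<open>d\<^sub>i = u\<^sub>i - v\<^sub>i\<close>.  Since \<open>u\<^sub>i v\<^sub>i = r\<^sub>i\<close>, twice the objective
  is the average of the \<open>u\<^sub>i + v\<^sub>i = sqrt (4 r\<^sub>i + d\<^sub>i\<^sup>2)\<close>, a convex even function of \<open>d\<close>, and the
  constraints become \<open>\<bar>d\<^sub>i\<bar> \<le> r\<^sub>i - 1\<close> and \<open>d\<^sub>1 + d\<^sub>2 + d\<^sub>3 = 0\<close>.  The maximum is attained at a vertex
  of this hexagon, where two of the \<open>d\<^sub>i\<close> are extremal with opposite signs; among the vertices the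
  best one leaves \<open>d\<^sub>3\<close> free.
\<close>

text \<open>The value is the norm of \<open>Complex (sqrt a) d\<close>, a point that moves affinely
  with \<open>d\<close>, so convexity is the triangle inequality.\<close>

lemma convex_on_sqrt_add_square:
  assumes "a \<ge> 0"
  shows "convex_on UNIV (\<lambda>d::real. sqrt (a + d\<^sup>2))"
proof (rule convex_onI)
  fix t x y :: real
  assume t: "0 < t" "t < 1"
  let ?z = "\<lambda>d. Complex (sqrt a) d"
  have n: "sqrt (a + d\<^sup>2) = cmod (?z d)" for d
    using assms by (simp add: cmod_def)
  have "?z ((1 - t) *\<^sub>R x + t *\<^sub>R y) = (1 - t) *\<^sub>R ?z x + t *\<^sub>R ?z y"
    by (simp add: complex_eq_iff algebra_simps)
  also have "cmod \<dots> \<le> (1 - t) * cmod (?z x) + t * cmod (?z y)"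
    using t by (intro norm_triangle_le) simp
  finally show "sqrt (a + ((1 - t) *\<^sub>R x + t *\<^sub>R y)\<^sup>2)
      \<le> (1 - t) * sqrt (a + x\<^sup>2) + t * sqrt (a + y\<^sup>2)"
    unfolding n .
qed simp

lemma convex_on_reflect:
  fixes f :: "real \<Rightarrow> real"
  assumes "convex_on UNIV f"
  shows "convex_on UNIV (\<lambda>x. f (s - x))"
proof (rule convex_onI)
  fix t x y :: real
  assume t: "0 < t" "t < 1"
  have "s - ((1 - t) *\<^sub>R x + t *\<^sub>R y) = (1 - t) *\<^sub>R (s - x) + t *\<^sub>R (s - y)"
    by (simp add: algebra_simps)
  then show "f (s - ((1 - t) *\<^sub>R x + t *\<^sub>R y)) \<le> (1 - t) * f (s - x) + t * f (s - y)"
    using convex_onD[OF assms, of t "s - x" "s - y"] t by simp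
qed simp

lemma convex_on_le_endpoints:
  fixes f :: "real \<Rightarrow> real"
  assumes f: "convex_on UNIV f" and x: "a \<le> x" "x \<le> b" and B: "f a \<le> B" "f b \<le> B"
  shows "f x \<le> B"
proof -
  have "x \<in> closed_segment a b"
    using x by (simp add: closed_segment_eq_real_ivl)
  then obtain t where t: "x = (1 - t) *\<^sub>R a + t *\<^sub>R b" "0 \<le> t" "t \<le> 1"
    unfolding closed_segment_def by blast
  have "f x \<le> (1 - t) * f a + t * f b"
    using convex_onD[OF f, of t a b] t by simp
  also have "\<dots> \<le> B"
    using t B by (intro convex_bound_le) auto
  finally show ?thesis .
qed

text \<open>Serves for segments along which one of three coordinates is frozen: the other two then
  have a constant sum \<open>s\<close>, so a single parameter drives both.\<close>

lemma convex_pair_le_endpoints: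
  fixes f g :: "real \<Rightarrow> real"
  assumes "convex_on UNIV f" "convex_on UNIV g" "a \<le> x" "x \<le> b"
    and "f (s - a) + g a \<le> B" "f (s - b) + g b \<le> B"
  shows "f (s - x) + g x \<le> B"
  using convex_on_le_endpoints[of "\<lambda>x. f (s - x) + g x"] assms
  by (simp add: convex_on_add convex_on_reflect)

text \<open>Slice the hexagon by \<open>z\<close>. Convexity within a slice pushes \<open>y\<close>
  to an end of its range, which lies on an edge; convexity along the edge then pushes the point to a
  vertex. Opposite vertices have equal values by evenness, so three bounds suffice:
  \<open>V1\<close>, \<open>V2\<close>, \<open>V3\<close> leave \<open>x\<close>, \<open>y\<close>,
  \<open>z\<close> free, respectively.\<close>

lemma even_convex_sum_le_on_hexagon:
  fixes f g h :: "real \<Rightarrow> real"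
  assumes cv: "convex_on UNIV f" "convex_on UNIV g" "convex_on UNIV h"
    and ev: "\<And>x. f (- x) = f x" "\<And>x. g (- x) = g x" "\<And>x. h (- x) = h x"
    and c: "c \<le> b" "b \<le> a" "a \<le> b + c"
    and V1: "f (b - c) + g b + h c \<le> B"
    and V2: "f a + g (a - c) + h c \<le> B"
    and V3: "f a + g b + h (a - b) \<le> B"
    and d: "\<bar>x\<bar> \<le> a" "\<bar>y\<bar> \<le> b" "\<bar>z\<bar> \<le> c" "x + y + z = 0"
  shows "f x + g y + h z \<le> B"
proof -
  \<comment> \<open>The edge \<open>y = b\<close>, joining vertices of the types \<open>V1\<close>
    and \<open>V3\<close>.\<close>
  have b_edge: "f (- b - w) + g b + h w \<le> B" if "- c \<le> w" "w \<le> a - b" for w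
  proof -
    have "f (- b - (- c)) = f (b - c)" "f (- b - (a - b)) = f a"
      using ev(1)[of "b - c"] ev(1)[of a] by simp_all
    then show ?thesis
      using convex_pair_le_endpoints[OF cv(1) cv(3) that, of "- b" "B - g b"] V1 V3 ev(3)[of c]
      by simp
  qed
  \<comment> \<open>The edge \<open>x = a\<close>, joining vertices of the types \<open>V2\<close>
    and \<open>V3\<close>.\<close>
  have a_edge: "f a + g (- a - w) + h w \<le> B" if "- c \<le> w" "w \<le> b - a" for w
  proof -
    have "g (- a - (- c)) = g (a - c)" "g (- a - (b - a)) = g b" "h (b - a) = h (a - b)"
      using ev(2)[of "a - c"] ev(2)[of b] ev(3)[of "a - b"] by simp_all
    then show ?thesis
      using convex_pair_le_endpoints[OF cv(2) cv(3) that, of "- a" "B - f a"] V2 V3 ev(3)[of c]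
      by simp
  qed
  \<comment> \<open>The largest \<open>y\<close> in the slice is limited by \<open>y \<le> b\<close>
    and by \<open>x = - z - y \<ge> - a\<close>. If the second limit binds, then
    \<open>x = - a\<close>, and reflection through the origin leads to
    \<open>a_edge\<close>.\<close>
  have upper: "f (- z - y') + g y' + h z \<le> B"
    if z: "\<bar>z\<bar> \<le> c" and y': "y' = min b (a - z)" for y' z
  proof (cases "b \<le> a - z")
    case True
    then show ?thesis
      using b_edge[of z] z y' by (simp add: minus_diff_commute)
  next
    case False
    moreover have "g (a - z) = g (- a - (- z))" "f (- a) = f a"
      using ev(2)[of "a - z"] ev(1) by simp_all
    ultimately show ?thesis
      using a_edge[of "- z"] z y' ev(3)[of z] by simp
  qed
  \<comment> \<open>The lower end of the slice at \<open>z\<close> is the negative of the upper end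
    of the slice at \<open>- z\<close>, so evenness reduces it to \<open>upper\<close>.\<close>
  define l u where "l = - min b (a + z)" and "u = min b (a - z)"
  have u: "f (- z - u) + g u + h z \<le> B"
    using upper[of z u] d u_def by simp
  have l: "f (- z - l) + g l + h z \<le> B"
  proof -
    have "f (- z - l) = f (z + l)"
      using ev(1)[of "z + l"] by simp
    then show ?thesis
      using upper[of "- z" "- l"] d l_def ev by simp
  qed
  have "f (- z - y) + g y \<le> B - h z"
    using d u l by (intro convex_pair_le_endpoints[OF cv(1,2), of l y u]) (auto simp: l_def u_def)
  moreover have "x = - z - y"
    using d by simp
  ultimately show ?thesis
    by simp
qed

text \<open>After adding \<open>c + 1\<close> to both sides, this compares two vertices at which the
  coordinate of ratio \<open>a\<close> is extremal: leaving the smaller ratio \<open>c\<close> free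
  beats leaving \<open>b\<close> free. The condition \<open>a + 1 \<le> b + c\<close> is equivalent
  to the first squared inequality below, which controls the cross term in the square of the
  right-hand side.\<close>

lemma vertex_value_le:
  fixes a b c :: real
  assumes "c \<le> b" "0 \<le> c" "a + 1 \<le> b + c"
  shows "sqrt (4 * b + (a - c)\<^sup>2) \<le> b - c + sqrt (4 * c + (a - b)\<^sup>2)"
proof -
  let ?A = "sqrt (4 * c + (a - b)\<^sup>2)"
  have "(a - b + 2)\<^sup>2 \<le> 4 * c + (a - b)\<^sup>2"
    using assms by (simp add: power2_eq_square algebra_simps)
  then have "a - b + 2 \<le> ?A"
    by (rule real_le_rsqrt)
  then have "2 * (b - c) * (a - b + 2) \<le> 2 * (b - c) * ?A"
    using assms by (intro mult_left_mono) auto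
  moreover have "4 * b + (a - c)\<^sup>2
      = (b - c)\<^sup>2 + 2 * (b - c) * (a - b + 2) + (4 * c + (a - b)\<^sup>2)"
    by (simp add: power2_eq_square algebra_simps)
  moreover have "?A\<^sup>2 = 4 * c + (a - b)\<^sup>2"
    using assms by simp
  ultimately have "4 * b + (a - c)\<^sup>2 \<le> (b - c + ?A)\<^sup>2"
    by (simp add: power2_sum)
  then show ?thesis
    using assms by (intro real_le_lsqrt) auto
qed

lemma sum_le_of_balanced:
  fixes r1 r2 r3 :: real
  assumes r: "r1 \<ge> r2" "r2 \<ge> r3" "r3 \<ge> 1" "r1 + 1 \<le> r2 + r3"
    and d: "\<bar>x\<bar> \<le> r1 - 1" "\<bar>y\<bar> \<le> r2 - 1" "\<bar>z\<bar> \<le> r3 - 1" "x + y + z = 0"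
  shows "sqrt (4 * r1 + x\<^sup>2) + sqrt (4 * r2 + y\<^sup>2) + sqrt (4 * r3 + z\<^sup>2)
    \<le> sqrt (4 * r3 + (r1 - r2)\<^sup>2) + (r1 + 1) + (r2 + 1)"
proof -
  \<comment> \<open>The contribution of an extremal coordinate.\<close>
  have end_val: "sqrt (4 * s + (s - 1)\<^sup>2) = s + 1" if "s \<ge> 1" for s :: real
    using that by (intro real_sqrt_unique) (auto simp: power2_eq_square algebra_simps)
  have e: "sqrt (4 * r1 + (r1 - 1)\<^sup>2) = r1 + 1" "sqrt (4 * r2 + (r2 - 1)\<^sup>2) = r2 + 1"
    "sqrt (4 * r3 + (r3 - 1)\<^sup>2) = r3 + 1"
    using r by (auto intro!: end_val)
  have V2: "sqrt (4 * r2 + (r1 - r3)\<^sup>2) \<le> r2 - r3 + sqrt (4 * r3 + (r1 - r2)\<^sup>2)"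
    using r by (intro vertex_value_le) auto
  \<comment> \<open>Here \<open>r3\<close> is the shared extremal ratio. Chained with
    \<open>V2\<close>, this ranks all three kinds of vertices.\<close>
  have V1: "sqrt (4 * r1 + (r2 - r3)\<^sup>2) \<le> r1 - r2 + sqrt (4 * r2 + (r1 - r3)\<^sup>2)"
    using r vertex_value_le[of r2 r1 r3] by (simp add: power2_commute[of r3])
  show ?thesis
  proof (rule even_convex_sum_le_on_hexagon[where a = "r1 - 1" and b = "r2 - 1" and c = "r3 - 1"
        and f = "\<lambda>d. sqrt (4 * r1 + d\<^sup>2)" and g = "\<lambda>d. sqrt (4 * r2 + d\<^sup>2)"
        and h = "\<lambda>d. sqrt (4 * r3 + d\<^sup>2)"])
    show "sqrt (4 * r1 + (r2 - 1 - (r3 - 1))\<^sup>2) + sqrt (4 * r2 + (r2 - 1)\<^sup>2)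
        + sqrt (4 * r3 + (r3 - 1)\<^sup>2) \<le> sqrt (4 * r3 + (r1 - r2)\<^sup>2) + (r1 + 1) + (r2 + 1)"
      using V1 V2 by (simp add: e)
  qed (use r d V2 in \<open>auto simp: e intro!: convex_on_sqrt_add_square\<close>)
qed

text \<open>The factors \<open>x / l\<close> and \<open>h / x\<close> have product
  \<open>h / l\<close> and both lie between 1 and \<open>h / l\<close>; the first claim is
  \<open>4uv + (u - v)\<^sup>2 = (u + v)\<^sup>2\<close>.\<close>

lemma fluctuation_bounds:
  fixes l h x :: real
  assumes "0 < l" "l \<le> x" "x \<le> h"
  shows "sqrt (4 * (h / l) + (x / l - h / x)\<^sup>2) = x / l + h / x"
    and "\<bar>x / l - h / x\<bar> \<le> h / l - 1"
proof -
  have "x > 0" "h > 0"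
    using assms by auto
  then have uv: "(x / l) * (h / x) = h / l"
    using assms by simp
  have "4 * (h / l) + (x / l - h / x)\<^sup>2 = (x / l + h / x)\<^sup>2"
    unfolding uv[symmetric] by (simp add: power2_eq_square algebra_simps)
  then show "sqrt (4 * (h / l) + (x / l - h / x)\<^sup>2) = x / l + h / x"
    using assms \<open>x > 0\<close> \<open>h > 0\<close> by simp
  have "x / l \<ge> 1" "h / x \<ge> 1" "x / l \<le> h / l" "h / x \<le> h / l"
    using assms \<open>x > 0\<close> by (auto simp: divide_right_mono intro: divide_left_mono)
  then show "\<bar>x / l - h / x\<bar> \<le> h / l - 1"
    by linarith
qed

text \<open>\<open>t\<close> is the positive root of \<open>t * (t + d) = s\<close>. It supplies the
  normalized price of the free objective when its difference has to be \<open>- d\<close>; the bound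
  \<open>1 \<le> t\<close> comes from \<open>d \<le> s - 1\<close>.\<close>

lemma balanced_point:
  fixes d s :: real
  assumes "0 \<le> d" "d \<le> s - 1"
  defines "t \<equiv> (sqrt (4 * s + d\<^sup>2) - d) / 2"
  shows "1 \<le> t" "t \<le> s" "t + d = s / t"
proof -
  have "(d + 2)\<^sup>2 \<le> 4 * s + d\<^sup>2" "4 * s + d\<^sup>2 \<le> (2 * s + d)\<^sup>2"
    using assms mult_mono[of 1 s 1 s] mult_nonneg_nonneg[of s "s - 1 + d"]
    by (auto simp: power2_eq_square algebra_simps)
  then have "d + 2 \<le> sqrt (4 * s + d\<^sup>2)" "sqrt (4 * s + d\<^sup>2) \<le> 2 * s + d"
    using assms by (auto intro: real_le_rsqrt real_le_lsqrt)
  then show t: "1 \<le> t" "t \<le> s"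
    by (simp_all add: t_def)
  have "2 * t + d = sqrt (4 * s + d\<^sup>2)"
    by (simp add: t_def diff_divide_distrib)
  then have "(2 * t + d)\<^sup>2 = 4 * s + d\<^sup>2"
    using assms by simp
  then have "(t + d) * t = s"
    by (simp add: power2_eq_square algebra_simps)
  then show "t + d = s / t"
    using t by (simp add: field_simps)
qed

theorem theorem5p2:
  fixes m M r :: "nat \<Rightarrow> real"
  assumes "price_intervals 3 m M"
    and "r = fluctuation_ratio m M"
    and "r 1 \<ge> r 2" and "r 2 \<ge> r 3" and "r 3 \<ge> 1"
    and "r 1 - 1 < (r 2 - 1) + (r 3 - 1)"
  shows "z_f 3 m M = 1 / 6 * (sqrt (4 * r 3 + (r 1 - r 2)\<^sup>2) + (r 1 + 1) + (r 2 + 1))"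
proof -
  have I: "{1..3::nat} = {1, 2, 3}"
    by auto
  have sum3: "(\<Sum>i=1..3. f i) = f 1 + f 2 + f 3" for f :: "nat \<Rightarrow> real"
    by (simp add: eval_nat_numeral)
  have m: "0 < m i" "m i \<le> M i" if "i \<in> {1, 2, 3}" for i
    using assms(1) that unfolding price_intervals_def I by auto
  have r: "r i = M i / m i" for i
    using assms(2) by (simp add: fluctuation_ratio_def)
  let ?V = "1 / 6 * (sqrt (4 * r 3 + (r 1 - r 2)\<^sup>2) + (r 1 + 1) + (r 2 + 1))"
  define t where "t = (sqrt (4 * r 3 + (r 1 - r 2)\<^sup>2) - (r 1 - r 2)) / 2"
  have t: "1 \<le> t" "t \<le> r 3" "t + (r 1 - r 2) = r 3 / t"
    using balanced_point[of "r 1 - r 2" "r 3"] assms unfolding t_def by auto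
  \<comment> \<open>The optimal vertex: the first price is maximal and the second minimal, so the
    first two differences are \<open>r 1 - 1\<close> and \<open>1 - r 2\<close>. The choice of
    \<open>t\<close> gives the third the value \<open>r 2 - r 1\<close>, which balances
    them.\<close>
  define x where "x = (\<lambda>i\<in>{1..3::nat}. if i = 1 then M 1 else if i = 2 then m 2 else m 3 * t)"
  have x: "x 1 = M 1" "x 2 = m 2" "x 3 = m 3 * t"
    by (simp_all add: x_def)
  have ext: "x \<in> extensional {1, 2, 3}"
    by (auto simp: x_def I)
  have pos: "0 < M i" if "i \<in> {1, 2, 3}" for i
    using m[OF that] by linarith
  have x_m: "(\<Sum>i=1..3. x i / m i) = r 1 + 1 + t"
    using m[of 2] m[of 3] unfolding sum3 x by (simp add: r)
  have "M 3 / (m 3 * t) = r 3 / t"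
    by (simp add: r)
  then have M_x: "(\<Sum>i=1..3. M i / x i) = 1 + r 2 + r 3 / t"
    using pos[of 1] unfolding sum3 x by (simp add: r)
  have "m 3 * t \<le> M 3" "m 3 \<le> m 3 * t"
    using t m[of 3] by (auto simp: r field_simps)
  then have "x \<in> (\<Pi>\<^sub>E i\<in>{1..3}. {m i..M i})"
    using m[of 1] m[of 2] unfolding PiE_iff by (simp add: I x ext del: One_nat_def)
  then have "x \<in> S_f 3 m M"
    unfolding S_f_def using x_m M_x t(3) by simp
  moreover have "1 / real 3 * (\<Sum>i=1..3. M i / x i) = ?V"
    unfolding M_x t(3)[symmetric] by (simp add: t_def field_simps)
  ultimately have attained: "?V \<in> (\<lambda>x. 1 / real 3 * (\<Sum>i=1..3. M i / x i)) ` S_f 3 m M"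
    by (metis (no_types, lifting) image_eqI)
  have bound: "1 / real 3 * (\<Sum>i=1..3. M i / y i) \<le> ?V" if "y \<in> S_f 3 m M" for y
  proof -
    have y: "m i \<le> y i" "y i \<le> M i" if "i \<in> {1, 2, 3}" for i
      using \<open>y \<in> S_f 3 m M\<close> that unfolding S_f_def I by (auto simp: PiE_iff)
    define u v d where "u i = y i / m i" and "v i = M i / y i" and "d i = u i - v i" for i
    have "(\<Sum>i=1..3. u i) = (\<Sum>i=1..3. v i)"
      using \<open>y \<in> S_f 3 m M\<close> by (simp add: S_f_def u_def v_def)
    then have bal: "u 1 + u 2 + u 3 = v 1 + v 2 + v 3"
      unfolding sum3 .
    have d: "sqrt (4 * r i + (d i)\<^sup>2) = u i + v i" "\<bar>d i\<bar> \<le> r i - 1"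
      if "i \<in> {1, 2, 3}" for i
      using fluctuation_bounds[OF m(1) y] that unfolding r d_def u_def v_def by auto
    \<comment> \<open>By \<open>bal\<close> the roots add up to twice the sum of the
      \<open>v i\<close>; together with the average over three objectives this gives the factor 6.
      In the instantiation \<open>r 2\<close> precedes \<open>r 1\<close> because
      \<open>r1 \<ge> r2\<close> abbreviates \<open>r2 \<le> r1\<close>.\<close>
    have "sqrt (4 * r 1 + (d 1)\<^sup>2) + sqrt (4 * r 2 + (d 2)\<^sup>2) + sqrt (4 * r 3 + (d 3)\<^sup>2)
        \<le> 6 * ?V"
      using sum_le_of_balanced[of "r 2" "r 1" "r 3" "d 1" "d 2" "d 3"] d(2) assms bal
      by (simp add: d_def)
    then have "1 / real 3 * (\<Sum>i=1..3. v i) \<le> ?V"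
      using d(1)[of 1] d(1)[of 2] d(1)[of 3] bal unfolding sum3 by simp
    then show ?thesis
      unfolding v_def .
  qed
  show ?thesis
    unfolding z_f_def using attained bound by (intro cSup_eq_maximum) auto
qed

end
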